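(* Let $f:\mathbb{R}^n\to\mathbb{R}$ be convex and differentiable with $L$-Lipschitz continuous gradient ($L>0$), let $g:\mathbb{R}^n\to\mathbb{R}\cup\{+\infty\}$ be proper, lower semicontinuous and convex, let $F=f+g$, and suppose $\min F>-\infty$ and $F$ is coercive. Let $(\beta_k)_{k\ge 0}\subseteq[0,1)$ be non-increasing with $$0<\inf_k\beta_k\le\beta_k\le\beta_0<1,$$ fix $0<c<1$, and set $\gamma_k=\frac{2(1-\beta_k)c}{L}$. Let $(x^k)_{k\ge 0}$ be generated by the proximal inertial gradient descent $$x^{k+1}=\mathbf{prox}_{\gamma_k g}\left[x^k-\gamma_k\nabla f(x^k)+\beta_k(x^k-x^{k-1})\right],\qquad k\ge 1,$$ from given initial points $x^0,x^1\in\mathbb{R}^n$. Then $$F(x^k)-\min F=O\left(\frac1k\right)\quad\text{as }k\to\infty.$$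
   Context: $\|\cdot\|$ is the Euclidean norm; $\mathbf{prox}_{\gamma g}(y)=\arg\min_z\{g(z)+\frac{1}{2\gamma}\|z-y\|^2\}$. Coercive means $F(x)\to+\infty$ as $\|x\|\to\infty$. $\min F$ denotes the minimum value of $F$, attained on the nonempty set $\arg\min F$. *)

theory Defs
  imports "HOL-Analysis.Analysis" "HOL-Library.Landau_Symbols"
begin

text \<open>
  Functions with values in the reals extended by plus infinity are modelled as
  \<^typ>\<open>ereal\<close>-valued functions; properness excludes the value minus infinity.
\<close>

definition proper_fun :: "('a \<Rightarrow> ereal) \<Rightarrow> bool" where
  "proper_fun h \<longleftrightarrow> (\<forall>x. h x \<noteq> - \<infinity>) \<and> (\<exists>x. h x \<noteq> \<infinity>)"

definition lsc_fun :: "('a::topological_space \<Rightarrow> ereal) \<Rightarrow> bool" where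
  "lsc_fun h \<longleftrightarrow> (\<forall>x. h x \<le> Liminf (at x) h)"

text \<open>
  The boundary cases \<open>u = 0\<close> and \<open>v = 0\<close> are harmless, since \<open>0 * \<infinity> = 0\<close> in
  \<^typ>\<open>ereal\<close>. The definition is meant for functions that avoid minus infinity.
\<close>

definition convex_fun :: "('a::real_vector \<Rightarrow> ereal) \<Rightarrow> bool" where
  "convex_fun h \<longleftrightarrow> (\<forall>x y. \<forall>u\<ge>0. \<forall>v\<ge>0. u + v = 1 \<longrightarrow>
     h (u *\<^sub>R x + v *\<^sub>R y) \<le> ereal u * h x + ereal v * h y)"

definition coercive_fun :: "('a::real_normed_vector \<Rightarrow> ereal) \<Rightarrow> bool" where
  "coercive_fun h \<longleftrightarrow> (h \<longlongrightarrow> \<infinity>) at_infinity"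

text \<open>The minimum as an attained value; unspecified if \<open>h\<close> has no minimiser.\<close>

definition min_value :: "('a \<Rightarrow> ereal) \<Rightarrow> ereal" where
  "min_value h = h (ARG_MIN h x. True)"

text \<open>
  Meaningful for \<open>\<gamma> > 0\<close> and proper, lower semicontinuous, convex \<open>g\<close> on a Euclidean
  space, where the minimiser exists and is unique.
\<close>

definition prox :: "real \<Rightarrow> ('a::real_normed_vector \<Rightarrow> ereal) \<Rightarrow> 'a \<Rightarrow> 'a" where
  "prox \<gamma> g y = (ARG_MIN (\<lambda>z. g z + ereal (1 / (2 * \<gamma>) * (norm (z - y))\<^sup>2)) z. True)"

end

theory Submission
  imports Defs
begin

text \<open>
  Write \<open>F*\<close> for the minimum, \<open>x*\<close> for a minimiser, \<open>d k = x k - x (k - 1)\<close>,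
  \<open>\<delta> k = \<beta> k / (2 \<gamma> k)\<close> and \<open>\<eta> = L (1 - c) / (2 c)\<close>. The prox inequality, the descent
  lemma and convexity of \<open>f\<close> give, for every \<open>z\<close> in the domain of \<open>g\<close>,
  \<open>F (x (k+1)) \<le> F z + \<langle>\<beta> k d k - d (k+1), x (k+1) - z\<rangle> / \<gamma> k + L/2 |d (k+1)|^2\<close>.
  With \<open>z = x k\<close> this shows that \<open>E k = F (x k) - F* + (\<delta> k + \<eta>/2) |d k|^2\<close> drops by at
  least \<open>\<eta>/2 (|d k|^2 + |d (k+1)|^2)\<close>; here \<open>\<delta>\<close> is non-increasing because \<open>\<beta>\<close> is. Coercivity
  then bounds the iterates, so \<open>z = x*\<close> gives \<open>E (k+1) \<le> C (|d k| + |d (k+1)|)\<close>. Together,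
  \<open>E (k+1)^2 \<le> K (E k - E (k+1))\<close>, which forces \<open>E k = O(1/k)\<close>.
\<close>

section \<open>Rate from a quadratic recurrence\<close>

text \<open>If \<open>a (Suc k)\<close> exceeded \<open>M / (k + 1)\<close>, the drop from
  \<open>a k \<le> M / k\<close> would be less than \<open>M / (k * (k + 1))\<close>, and the
  recurrence would force \<open>M / (k + 1) < K / k\<close>. As \<open>k + 1 \<le> 2 * k\<close>,
  this contradicts \<open>M \<ge> 2 * K\<close>.\<close>

lemma quadratic_recurrence_rate:
  fixes a :: "nat \<Rightarrow> real"
  assumes N: "N \<ge> 1" and K: "K \<ge> 0"
    and rec: "\<And>k. k \<ge> N \<Longrightarrow> (a (Suc k))\<^sup>2 \<le> K * (a k - a (Suc k))"
  shows "\<exists>M. \<forall>k\<ge>N. a k \<le> M / real k"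
proof -
  \<comment> \<open>\<open>2 * K\<close> serves the induction step, \<open>N * a N\<close> the base
    case, and 1 keeps \<open>M\<close> positive so that \<open>A\<close> can be cancelled.\<close>
  define M where "M = max (2 * K) (max (real N * a N) 1)"
  have M: "M \<ge> 2 * K" "M \<ge> real N * a N" "M > 0"
    by (auto simp: M_def)
  have "a k \<le> M / real k" if "k \<ge> N" for k
    using that
  proof (induction k rule: dec_induct)
    case base
    show ?case
      using M(2) N by (simp add: field_simps)
  next
    case (step k)
    show ?case
    proof (rule ccontr)
      assume "\<not> ?thesis"
      then have big: "M / real (Suc k) < a (Suc k)"
        by simp
      have k: "real k \<ge> 1"
        using step N by simp
      define A where "A = M / real (Suc k)"
      have A: "A > 0" "A < a (Suc k)"
        using M(3) big by (auto simp: A_def)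
      have "A * A < a (Suc k) * a (Suc k)"
        using A by (intro mult_strict_mono) auto
      also have "\<dots> \<le> K * (a k - a (Suc k))"
        using rec[of k] step by (simp add: power2_eq_square)
      also have "\<dots> \<le> K * (M / real k - A)"
        using K A step by (intro mult_left_mono) auto
      also have "M / real k - A = A * (1 / real k)"
        using k by (simp add: A_def field_simps)
      finally have "A * A < A * (K / real k)"
        by (simp add: mult.commute)
      then have "A < K / real k"
        using A(1) by (simp only: mult_less_cancel_left_pos)
      then have "M * real k < K * real (Suc k)"
        using k by (simp add: A_def field_simps)
      also have "\<dots> \<le> K * (2 * real k)"
        using k K by (intro mult_left_mono) auto
      also have "\<dots> \<le> M * real k"
        using M(1) k by simp
      finally show False
        by simp
    qed
  qed
  then show ?thesis
    by blast
qed

section \<open>Smooth convex functions along lines\<close>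

lemma gderiv_along_line:
  fixes f :: "'a::real_inner \<Rightarrow> real"
  assumes "GDERIV f (x + t *\<^sub>R v) :> D"
  shows "((\<lambda>t. f (x + t *\<^sub>R v)) has_real_derivative (D \<bullet> v)) (at t)"
proof -
  have "((\<lambda>t. x + t *\<^sub>R v) has_derivative (\<lambda>h. h *\<^sub>R v)) (at t)"
    by (auto intro!: derivative_eq_intros)
  moreover have "(f has_derivative (\<lambda>h. h \<bullet> D)) (at (x + t *\<^sub>R v))"
    using assms by (simp add: gderiv_def)
  ultimately have "((\<lambda>t. f (x + t *\<^sub>R v)) has_derivative (\<lambda>h. (h *\<^sub>R v) \<bullet> D)) (at t)"
    using has_derivative_compose by blast
  moreover have "(\<lambda>h. (h *\<^sub>R v) \<bullet> D) = (*) (D \<bullet> v)"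
    by (auto simp: fun_eq_iff inner_commute)
  ultimately show ?thesis
    by (simp add: has_field_derivative_def)
qed

text \<open>Restricted to the line through \<open>x\<close> and \<open>y\<close>, \<open>f\<close>
  is a convex function of one variable and lies above its tangent at 0; the claim is the case of
  parameter 1.\<close>

lemma convex_gradient_inequality:
  fixes f :: "'a::real_inner \<Rightarrow> real"
  assumes "convex_on UNIV f" and "GDERIV f x :> D"
  shows "f x + D \<bullet> (y - x) \<le> f y"
proof -
  have "convex_on UNIV (\<lambda>t. f (x + t *\<^sub>R (y - x)))"
  proof (rule convex_onI)
    fix t r s :: real
    assume t: "0 < t" "t < 1"
    have "x + ((1 - t) *\<^sub>R r + t *\<^sub>R s) *\<^sub>R (y - x)
        = (1 - t) *\<^sub>R (x + r *\<^sub>R (y - x)) + t *\<^sub>R (x + s *\<^sub>R (y - x))"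
      by (simp add: algebra_simps)
    then show "f (x + ((1 - t) *\<^sub>R r + t *\<^sub>R s) *\<^sub>R (y - x))
        \<le> (1 - t) * f (x + r *\<^sub>R (y - x)) + t * f (x + s *\<^sub>R (y - x))"
      using convex_onD[OF assms(1), of t] t by simp
  qed simp
  moreover have "((\<lambda>t. f (x + t *\<^sub>R (y - x))) has_real_derivative (D \<bullet> (y - x))) (at 0)"
    using assms(2) by (intro gderiv_along_line) simp
  ultimately show ?thesis
    using convex_on_imp_above_tangent[of UNIV "\<lambda>t. f (x + t *\<^sub>R (y - x))" 0 1 "D \<bullet> (y - x)"]
    by simp
qed

text \<open>Subtracting the linear and quadratic terms of the bound from \<open>f\<close> along the
  segment leaves \<open>\<phi>\<close>, whose derivative is non-positive by Cauchy-Schwarz and the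
  Lipschitz condition; the claim is \<open>\<phi> 1 \<le> \<phi> 0\<close>.\<close>

lemma lipschitz_gradient_descent:
  fixes f :: "'a::real_inner \<Rightarrow> real"
  assumes grad: "\<And>z. GDERIV f z :> gradf z" and lip: "L-lipschitz_on UNIV gradf"
  shows "f y \<le> f x + gradf x \<bullet> (y - x) + L / 2 * (norm (y - x))\<^sup>2"
proof -
  define v where "v = y - x"
  define \<phi> where
    "\<phi> t = f (x + t *\<^sub>R v) - t * (gradf x \<bullet> v) - L / 2 * t\<^sup>2 * (norm v)\<^sup>2" for t
  have "\<phi> 1 \<le> \<phi> 0"
  proof (rule DERIV_nonpos_imp_nonincreasing[of 0 1 \<phi>])
    fix t :: real
    assume t: "0 \<le> t" "t \<le> 1"
    have "(\<phi> has_real_derivative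
        (gradf (x + t *\<^sub>R v) \<bullet> v - gradf x \<bullet> v - L * t * (norm v)\<^sup>2)) (at t)"
      unfolding \<phi>_def
      by (rule derivative_eq_intros gderiv_along_line[OF grad] refl)+ simp
    moreover have "gradf (x + t *\<^sub>R v) \<bullet> v - gradf x \<bullet> v \<le> L * t * (norm v)\<^sup>2"
    proof -
      have "gradf (x + t *\<^sub>R v) \<bullet> v - gradf x \<bullet> v = (gradf (x + t *\<^sub>R v) - gradf x) \<bullet> v"
        by (simp add: inner_diff_left)
      also have "\<dots> \<le> norm (gradf (x + t *\<^sub>R v) - gradf x) * norm v"
        by (rule norm_cauchy_schwarz)
      also have "\<dots> \<le> (L * norm (t *\<^sub>R v)) * norm v"
        using lipschitz_onD[OF lip, of "x + t *\<^sub>R v" x]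
        by (intro mult_right_mono) (auto simp: dist_norm)
      also have "\<dots> = L * t * (norm v)\<^sup>2"
        using t by (simp add: power2_eq_square)
      finally show ?thesis .
    qed
    ultimately show "\<exists>d. (\<phi> has_real_derivative d) (at t) \<and> d \<le> 0"
      by (metis diff_le_0_iff_le)
  qed simp_all
  then show ?thesis
    by (simp add: \<phi>_def v_def)
qed

section \<open>Lower semicontinuity and existence of minimisers\<close>

text \<open>\<open>Liminf (at z)\<close> only sees a punctured neighbourhood of \<open>z\<close>;
  the centre is supplied by \<open>a < h z\<close>.\<close>

lemma lsc_fun_open_superlevel:
  assumes "lsc_fun h"
  shows "open {z. a < h z}"
proof (subst open_subopen, rule ballI)
  fix z assume "z \<in> {z. a < h z}"
  then have z: "a < h z"
    by simp
  then have "a < Liminf (at z) h"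
    using assms less_le_trans[of a "h z" "Liminf (at z) h"] by (simp add: lsc_fun_def)
  then have "\<forall>\<^sub>F w in at z. a < h w"
    by (rule less_LiminfD)
  then obtain T where "open T" "z \<in> T" "\<forall>w\<in>T. w \<noteq> z \<longrightarrow> a < h w"
    unfolding eventually_at_topological by (meson UNIV_I)
  then have "T \<subseteq> {z. a < h z}"
    using z by (metis mem_Collect_eq subsetI)
  then show "\<exists>T. open T \<and> z \<in> T \<and> T \<subseteq> {z. a < h z}"
    using \<open>open T\<close> \<open>z \<in> T\<close> by blast
qed

text \<open>Without a minimiser, the open sets \<open>{z. h y < h z}\<close> with \<open>y\<close>
  in \<open>K\<close> cover \<open>K\<close>. In a finite subcover, the index with the least value
  would itself lie in one of the sets, giving an index with a smaller value.\<close>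

lemma lsc_fun_attains_min:
  fixes h :: "'a::topological_space \<Rightarrow> ereal"
  assumes lsc: "lsc_fun h" and K: "compact K" "K \<noteq> {}"
  shows "\<exists>p\<in>K. \<forall>z\<in>K. h p \<le> h z"
proof (rule ccontr)
  assume contra: "\<not> (\<exists>p\<in>K. \<forall>z\<in>K. h p \<le> h z)"
  have cov: "K \<subseteq> (\<Union>y\<in>K. {z. h y < h z})"
  proof
    fix z assume "z \<in> K"
    then have "\<exists>y\<in>K. h y < h z"
      using contra by (simp add: not_le)
    then show "z \<in> (\<Union>y\<in>K. {z. h y < h z})"
      by simp
  qed
  have op: "\<And>y. y \<in> K \<Longrightarrow> open {z. h y < h z}"
    using lsc by (rule lsc_fun_open_superlevel)
  obtain Y where Y: "Y \<subseteq> K" "finite Y" "K \<subseteq> (\<Union>y\<in>Y. {z. h y < h z})"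
    by (rule compactE_image[OF K(1) op cov])
  have "Y \<noteq> {}"
    using Y(3) K(2) by auto
  then have "Min (h ` Y) \<in> h ` Y"
    using Y(2) by simp
  then obtain y where y: "y \<in> Y" "h y = Min (h ` Y)"
    by auto
  obtain w where "w \<in> Y" "h w < h y"
    using Y(1,3) y(1) by blast
  moreover have "Min (h ` Y) \<le> h w"
    using Y(2) \<open>w \<in> Y\<close> by simp
  ultimately show False
    using y(2) by simp
qed

lemma lsc_fun_attains_global_min:
  fixes h :: "'a::heine_borel \<Rightarrow> ereal"
  assumes lsc: "lsc_fun h" and lev: "bounded {z. h z \<le> h w}"
  shows "\<exists>p. \<forall>z. h p \<le> h z"
proof -
  have "- {z. h z \<le> h w} = {z. h w < h z}"
    by auto
  then have "closed {z. h z \<le> h w}"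
    using lsc_fun_open_superlevel[OF lsc, of "h w"] by (simp add: closed_def)
  then have cpt: "compact {z. h z \<le> h w}"
    using lev by (simp add: compact_eq_bounded_closed)
  have ne: "{z. h z \<le> h w} \<noteq> {}"
    by blast
  obtain p where p: "h p \<le> h w" and min: "\<forall>z\<in>{z. h z \<le> h w}. h p \<le> h z"
    using lsc_fun_attains_min[OF lsc cpt ne] by auto
  have "h p \<le> h z" for z
  proof (cases "h z \<le> h w")
    case False
    then show ?thesis
      using p by auto
  qed (use min in simp)
  then show ?thesis
    by blast
qed

text \<open>A real \<open>b\<close> strictly between \<open>a - f z\<close> and \<open>h z\<close>
  splits the claim: near \<open>z\<close>, \<open>h\<close> stays above \<open>b\<close> by
  semicontinuity and \<open>f\<close> above \<open>a - b\<close> by continuity.\<close>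

lemma lsc_fun_add_continuous:
  fixes h :: "'a::topological_space \<Rightarrow> ereal"
  assumes lsc: "lsc_fun h" and f: "continuous_on UNIV f"
  shows "lsc_fun (\<lambda>z. ereal (f z) + h z)"
  unfolding lsc_fun_def le_Liminf_iff
proof (intro allI impI)
  fix z a assume a: "a < ereal (f z) + h z"
  have "a - ereal (f z) < h z"
    using a by (cases a; cases "h z") auto
  then obtain b where b: "a - ereal (f z) < ereal b" "ereal b < h z"
    using ereal_dense2[of "a - ereal (f z)" "h z"] by auto
  have "open {w. ereal b < h w}"
    using lsc by (rule lsc_fun_open_superlevel)
  then have ev_h: "\<forall>\<^sub>F w in at z. ereal b < h w"
    using b(2) by (auto simp: eventually_at_topological)
  show "\<forall>\<^sub>F w in at z. a < ereal (f w) + h w"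
  proof (cases a)
    case (real r)
    have "(f \<longlongrightarrow> f z) (at z)"
      using f by (auto simp: continuous_on_def)
    moreover have "r - b < f z"
      using b(1) real by simp
    ultimately have "\<forall>\<^sub>F w in at z. r - b < f w"
      by (rule order_tendstoD)
    with ev_h show ?thesis
    proof eventually_elim
      case (elim w)
      then show ?case
        using real by (cases "h w") auto
    qed
  next
    case PInf
    then show ?thesis
      using a by simp
  next
    case MInf
    show ?thesis
      using ev_h
    proof eventually_elim
      case (elim w)
      then show ?case
        using MInf by (cases "h w") auto
    qed
  qed
qed

text \<open>Once some minimiser exists, the point chosen by \<open>ARG_MIN\<close> is one too; this
  gives meaning to \<open>prox\<close> and \<open>min_value\<close>.\<close>

lemma ARG_MIN_le:
  fixes h :: "'a \<Rightarrow> 'b::linorder"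
  assumes "\<And>z. h p \<le> h z"
  shows "h (ARG_MIN h z. True) \<le> h w"
proof (rule arg_minI[where P = "\<lambda>_. True" and x = p and f = h])
  show "\<not> h y < h p" for y
    using assms by (simp add: not_less)
  show "h z \<le> h w" if "\<forall>y. True \<longrightarrow> \<not> h y < h z" for z
    using that by (simp add: not_less)
qed simp

section \<open>Linear lower bound for convex functions\<close>

lemma convex_funD:
  assumes "convex_fun h" "0 \<le> t" "t \<le> 1"
  shows "h ((1 - t) *\<^sub>R x + t *\<^sub>R y) \<le> ereal (1 - t) * h x + ereal t * h y"
  using assms by (simp add: convex_fun_def)

text \<open>
  Outside the unit ball around a point \<open>x0\<close> of the domain, \<open>g z\<close> is bounded below through the
  point of the segment from \<open>x0\<close> to \<open>z\<close> on the unit sphere, where \<open>g\<close> exceeds its minimum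
  over the ball. This replaces the usual affine minorant obtained by separation.
\<close>
lemma lsc_convex_linear_lower_bound:
  fixes g :: "'a::euclidean_space \<Rightarrow> ereal"
  assumes proper: "proper_fun g" and lsc: "lsc_fun g" and conv: "convex_fun g"
  shows "\<exists>x0 C. C \<ge> 0 \<and> \<bar>g x0\<bar> \<noteq> \<infinity> \<and> (\<forall>z. ereal (- (C * (1 + norm (z - x0)))) \<le> g z)"
proof -
  have gm: "g z \<noteq> - \<infinity>" for z
    using proper by (simp add: proper_fun_def)
  obtain x0 where "g x0 \<noteq> \<infinity>"
    using proper by (auto simp: proper_fun_def)
  then obtain r0 where r0: "g x0 = ereal r0"
    using gm[of x0] by (cases "g x0") auto
  have "cball x0 (1::real) \<noteq> {}"
    by simp
  then obtain p where p: "\<forall>z\<in>cball x0 1. g p \<le> g z"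
    using lsc_fun_attains_min[OF lsc compact_cball] by blast
  have "g p \<le> ereal r0"
    using bspec[OF p, of x0] r0 by simp
  then obtain m where m: "g p = ereal m"
    using gm[of p] by (cases "g p") auto
  \<comment> \<open>The bounds to be dominated are \<open>m\<close> inside the ball and
    \<open>r * m - (r - 1) * r0\<close> at distance \<open>r > 1\<close>.\<close>
  define C where "C = \<bar>m\<bar> + \<bar>r0\<bar>"
  have "ereal (- (C * (1 + norm (z - x0)))) \<le> g z" for z
  proof (cases "g z")
    case (real s)
    define r where "r = norm (z - x0)"
    have "- (C * (1 + r)) \<le> s"
    proof (cases "r \<le> 1")
      case True
      then have "m \<le> s"
        using bspec[OF p, of z] m real by (simp add: r_def dist_norm norm_minus_commute)
      moreover have "C * 1 \<le> C * (1 + r)"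
        by (intro mult_left_mono) (auto simp: C_def r_def)
      ultimately show ?thesis
        by (simp add: C_def)
    next
      case False
      define w where "w = (1 - 1 / r) *\<^sub>R x0 + (1 / r) *\<^sub>R z"
      have "w - x0 = (1 / r) *\<^sub>R (z - x0)"
        by (simp add: w_def algebra_simps)
      then have "norm (w - x0) = 1"
        using False by (auto simp: r_def)
      then have "g p \<le> g w"
        by (intro bspec[OF p]) (simp add: dist_norm norm_minus_commute)
      also have "g w \<le> ereal (1 - 1 / r) * g x0 + ereal (1 / r) * g z"
        unfolding w_def using False by (intro convex_funD conv) auto
      finally have "m \<le> (1 - 1 / r) * r0 + (1 / r) * s"
        by (simp add: m r0 real)
      then have "r * m \<le> r * ((1 - 1 / r) * r0 + (1 / r) * s)"
        using False by (intro mult_left_mono) auto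
      also have "\<dots> = (r - 1) * r0 + s"
        using False by (simp add: field_simps)
      finally have "r * m - (r - 1) * r0 \<le> s"
        by simp
      moreover have "- (r * \<bar>m\<bar>) \<le> r * m"
        using False abs_le_D2[of m "\<bar>m\<bar>"] mult_left_mono[of "- \<bar>m\<bar>" m r] by simp
      moreover have "(r - 1) * r0 \<le> (r - 1) * \<bar>r0\<bar>"
        using False by (intro mult_left_mono) auto
      ultimately show ?thesis
        by (simp add: C_def algebra_simps)
    qed
    then show ?thesis
      by (simp add: real r_def)
  qed (use gm in auto)
  moreover have "C \<ge> 0"
    by (simp add: C_def)
  ultimately show ?thesis
    using r0 by (intro exI[of _ x0] exI[of _ C]) simp
qed

section \<open>The proximal map\<close>

text \<open>The quadratic term outgrows the linear lower bound of \<open>g\<close>, so the prox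
  objective has a bounded level set and its minimum is attained.\<close>

lemma prox_le:
  fixes g :: "'a::euclidean_space \<Rightarrow> ereal"
  assumes g: "proper_fun g" "lsc_fun g" "convex_fun g" and \<gamma>: "\<gamma> > 0"
  shows "g (prox \<gamma> g y) + ereal (1 / (2 * \<gamma>) * (norm (prox \<gamma> g y - y))\<^sup>2)
    \<le> g z + ereal (1 / (2 * \<gamma>) * (norm (z - y))\<^sup>2)"
proof -
  define q where "q = 1 / (2 * \<gamma>)"
  define h where "h z = ereal (q * (norm (z - y))\<^sup>2) + g z" for z
  have q: "q > 0"
    using \<gamma> by (simp add: q_def)
  obtain x0 C where C: "C \<ge> 0" "\<bar>g x0\<bar> \<noteq> \<infinity>"
    and lower: "\<forall>z. ereal (- (C * (1 + norm (z - x0)))) \<le> g z"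
    using lsc_convex_linear_lower_bound[OF g] by (elim exE conjE) (rule that)
  obtain b where b: "h x0 = ereal b"
    using C(2) by (cases "g x0") (auto simp: h_def)
  \<comment> \<open>On the level set, \<open>n = norm (z - y)\<close> satisfies
    \<open>n * (q * n - C) \<le> B\<close>. The radius \<open>R\<close> is at least 1 and makes
    \<open>q * R - C\<close> exceed \<open>\<bar>B\<bar>\<close>, so \<open>n > R\<close> is
    impossible.\<close>
  define B where "B = b + C + C * norm (y - x0)"
  define R where "R = 1 + (C + \<bar>B\<bar>) / q"
  have "norm (z - y) \<le> R" if z: "h z \<le> h x0" for z
  proof (rule ccontr)
    assume "\<not> ?thesis"
    then have t: "norm (z - y) > R"
      by simp
    have R1: "R \<ge> 1"
      using C(1) q by (simp add: R_def)
    have "ereal (q * (norm (z - y))\<^sup>2) + ereal (- (C * (1 + norm (z - x0)))) \<le> h z"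
      unfolding h_def by (intro add_left_mono spec[OF lower])
    also have "\<dots> \<le> ereal b"
      using z b by simp
    finally have "q * (norm (z - y))\<^sup>2 - C * (1 + norm (z - x0)) \<le> b"
      by simp
    moreover have "C * norm (z - x0) \<le> C * (norm (z - y) + norm (y - x0))"
      using C(1) norm_triangle_ineq[of "z - y" "y - x0"] by (intro mult_left_mono) auto
    ultimately have "norm (z - y) * (q * norm (z - y) - C) \<le> B"
      by (simp add: B_def algebra_simps power2_eq_square)
    moreover have "q * R - C = q + \<bar>B\<bar>"
      using q by (simp add: R_def field_simps)
    then have "q * norm (z - y) - C > \<bar>B\<bar>"
      using t q mult_strict_left_mono[of R "norm (z - y)" q] by linarith
    then have "norm (z - y) * (q * norm (z - y) - C) > \<bar>B\<bar>"
      using t R1 mult_mono[of 1 "norm (z - y)" "\<bar>B\<bar>" "\<bar>B\<bar>"]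
        mult_strict_left_mono[of "\<bar>B\<bar>" "q * norm (z - y) - C" "norm (z - y)"] by linarith
    ultimately show False
      by linarith
  qed
  then have "{z. h z \<le> h x0} \<subseteq> cball y R"
    by (auto simp: dist_norm norm_minus_commute)
  then have "bounded {z. h z \<le> h x0}"
    using bounded_cball bounded_subset by blast
  moreover have "lsc_fun h"
    unfolding h_def by (intro lsc_fun_add_continuous g continuous_intros)
  ultimately obtain p where "\<And>z. h p \<le> h z"
    using lsc_fun_attains_global_min[of h x0] by auto
  then have "h (ARG_MIN h z. True) \<le> h z"
    by (rule ARG_MIN_le)
  moreover have "(ARG_MIN h z. True) = prox \<gamma> g y"
    by (simp add: prox_def h_def[abs_def] q_def add.commute)
  ultimately show ?thesis
    by (simp add: h_def q_def add.commute)
qed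

text \<open>Let \<open>t\<close> tend to 0 from the right. This removes the second-order term in the
  optimality condition below.\<close>

lemma le_of_linear_perturbation:
  fixes a b c :: real
  assumes "\<And>t. 0 < t \<Longrightarrow> t < 1 \<Longrightarrow> a \<le> b + t * c"
  shows "a \<le> b"
proof (rule tendsto_lowerbound)
  show "((\<lambda>t. b + t * c) \<longlongrightarrow> b) (at_right 0)"
    by (auto intro!: tendsto_eq_intros)
  have "\<forall>\<^sub>F t in at_right 0. t \<in> {0<..<1::real}"
    by (rule eventually_at_right_real) simp
  then show "\<forall>\<^sub>F t in at_right 0. a \<le> b + t * c"
    by eventually_elim (use assms in auto)
qed simp

lemma prox_finite:
  fixes g :: "'a::euclidean_space \<Rightarrow> ereal"
  assumes g: "proper_fun g" "lsc_fun g" "convex_fun g" and \<gamma>: "\<gamma> > 0"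
  shows "\<bar>g (prox \<gamma> g y)\<bar> \<noteq> \<infinity>"
proof -
  obtain z where "g z \<noteq> \<infinity>"
    using g(1) by (auto simp: proper_fun_def)
  moreover have "g w \<noteq> - \<infinity>" for w
    using g(1) by (simp add: proper_fun_def)
  ultimately show ?thesis
    using prox_le[OF g \<gamma>, of y z] by (cases "g z"; cases "g (prox \<gamma> g y)") auto
qed

text \<open>First-order optimality without subdifferentials: compare \<open>p\<close> with
  \<open>(1 - t) *\<^sub>R p + t *\<^sub>R z\<close>, expand the square, divide by \<open>t\<close>
  and let \<open>t\<close> tend to 0.\<close>

lemma prox_variational_inequality:
  fixes g :: "'a::euclidean_space \<Rightarrow> ereal"
  assumes g: "proper_fun g" "lsc_fun g" "convex_fun g" and \<gamma>: "\<gamma> > 0"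
    and z: "\<bar>g z\<bar> \<noteq> \<infinity>" and p: "p = prox \<gamma> g y"
  shows "real_of_ereal (g p) \<le> real_of_ereal (g z) + 1 / \<gamma> * ((y - p) \<bullet> (p - z))"
proof -
  define q where "q = 1 / (2 * \<gamma>)"
  obtain P Z where P: "g p = ereal P" and Z: "g z = ereal Z"
    using z prox_finite[OF g \<gamma>, of y] p by (cases "g p"; cases "g z") auto
  have "P \<le> (Z + 1 / \<gamma> * ((y - p) \<bullet> (p - z))) + t * (q * (norm (z - p))\<^sup>2)"
    if t: "0 < t" "t < 1" for t
  proof -
    define w where "w = (1 - t) *\<^sub>R p + t *\<^sub>R z"
    have "g w \<le> ereal (1 - t) * g p + ereal t * g z"
      unfolding w_def using t by (intro convex_funD g) auto
    then have gw: "g w \<le> ereal ((1 - t) * P + t * Z)"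
      by (simp add: P Z)
    have "g p + ereal (q * (norm (p - y))\<^sup>2) \<le> g w + ereal (q * (norm (w - y))\<^sup>2)"
      unfolding q_def p by (rule prox_le[OF g \<gamma>])
    also have "\<dots> \<le> ereal ((1 - t) * P + t * Z) + ereal (q * (norm (w - y))\<^sup>2)"
      using gw by (rule add_right_mono)
    finally have 1: "P + q * (norm (p - y))\<^sup>2 \<le> (1 - t) * P + t * Z + q * (norm (w - y))\<^sup>2"
      by (simp add: P)
    have "w - y = (p - y) + t *\<^sub>R (z - p)"
      by (simp add: w_def algebra_simps)
    then have "(norm (w - y))\<^sup>2 = (norm ((p - y) + t *\<^sub>R (z - p)))\<^sup>2"
      by (rule arg_cong)
    also have "\<dots>
        = (norm (p - y))\<^sup>2 + 2 * t * ((p - y) \<bullet> (z - p)) + t\<^sup>2 * (norm (z - p))\<^sup>2"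
      unfolding power2_norm_eq_inner inner_add_left inner_add_right
      by (simp add: inner_commute[of "z - p" "p - y"] power2_eq_square)
    also have "(p - y) \<bullet> (z - p) = (y - p) \<bullet> (p - z)"
      by (metis inner_minus_left inner_minus_right minus_diff_eq minus_minus)
    finally have nw: "(norm (w - y))\<^sup>2
        = (norm (p - y))\<^sup>2 + 2 * t * ((y - p) \<bullet> (p - z)) + t\<^sup>2 * (norm (z - p))\<^sup>2" .
    have "q * (norm (w - y))\<^sup>2
        = q * (norm (p - y))\<^sup>2 + t * (2 * q * ((y - p) \<bullet> (p - z))) + t * (t * (q * (norm (z - p))\<^sup>2))"
      unfolding nw by (simp only: distrib_left power2_eq_square ac_simps)
    with 1 have "t * P \<le> t * Z + t * (2 * q * ((y - p) \<bullet> (p - z))) + t * (t * (q * (norm (z - p))\<^sup>2))"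
      by (simp only: left_diff_distrib mult_1_left)
    then have "t * P \<le> t * (Z + 2 * q * ((y - p) \<bullet> (p - z)) + t * (q * (norm (z - p))\<^sup>2))"
      by (simp only: distrib_left)
    then have "P \<le> Z + 2 * q * ((y - p) \<bullet> (p - z)) + t * (q * (norm (z - p))\<^sup>2)"
      using t by (simp only: mult_le_cancel_left_pos)
    then show ?thesis
      by (simp add: q_def)
  qed
  then have "P \<le> Z + 1 / \<gamma> * ((y - p) \<bullet> (p - z))"
    by (rule le_of_linear_perturbation)
  then show ?thesis
    by (simp add: P Z)
qed

section \<open>The one-step inequality\<close>

text \<open>Add the prox inequality, the descent lemma from \<open>x\<close> to \<open>p\<close> and
  the gradient inequality from \<open>x\<close> to \<open>z\<close>: all terms in
  \<open>gradf x\<close> cancel. The vector \<open>w\<close> will be the inertial term.\<close>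

lemma prox_gradient_step:
  fixes f :: "'a::euclidean_space \<Rightarrow> real" and g :: "'a \<Rightarrow> ereal"
  assumes f: "convex_on UNIV f" "\<And>z. GDERIV f z :> gradf z" "L-lipschitz_on UNIV gradf"
    and g: "proper_fun g" "lsc_fun g" "convex_fun g" and \<gamma>: "\<gamma> > 0"
    and z: "\<bar>g z\<bar> \<noteq> \<infinity>" and p: "p = prox \<gamma> g (x - \<gamma> *\<^sub>R gradf x + w)"
  shows "f p + real_of_ereal (g p) \<le> f z + real_of_ereal (g z)
    + 1 / \<gamma> * ((w - (p - x)) \<bullet> (p - z)) + L / 2 * (norm (p - x))\<^sup>2"
proof -
  have "real_of_ereal (g p) \<le> real_of_ereal (g z)
      + 1 / \<gamma> * ((x - \<gamma> *\<^sub>R gradf x + w - p) \<bullet> (p - z))"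
    by (rule prox_variational_inequality[OF g \<gamma> z p])
  also have "x - \<gamma> *\<^sub>R gradf x + w - p = (w - (p - x)) - \<gamma> *\<^sub>R gradf x"
    by simp
  also have "1 / \<gamma> * ((w - (p - x) - \<gamma> *\<^sub>R gradf x) \<bullet> (p - z))
      = 1 / \<gamma> * ((w - (p - x)) \<bullet> (p - z)) - gradf x \<bullet> (p - z)"
    using \<gamma> by (subst inner_diff_left) (simp add: field_simps)
  finally have "real_of_ereal (g p) \<le> real_of_ereal (g z)
      + (1 / \<gamma> * ((w - (p - x)) \<bullet> (p - z)) - gradf x \<bullet> (p - z))" .
  moreover have "f p \<le> f x + gradf x \<bullet> (p - x) + L / 2 * (norm (p - x))\<^sup>2"
    using f(2,3) by (rule lipschitz_gradient_descent)
  moreover have "f x + gradf x \<bullet> (z - x) \<le> f z"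
    using f(1,2) by (rule convex_gradient_inequality)
  moreover have "gradf x \<bullet> (p - x) = gradf x \<bullet> (p - z) + gradf x \<bullet> (z - x)"
    by (simp add: inner_diff_right)
  ultimately show ?thesis
    by linarith
qed

section \<open>Energy argument for the inertial iteration\<close>

text \<open>The rate follows from the one-step inequality alone, for a real-valued
  \<open>\<phi>\<close> on its domain \<open>D\<close>. Membership in \<open>D\<close> starts at
  index 2, since the initial points are arbitrary.\<close>

lemma inertial_descent_rate:
  fixes x :: "nat \<Rightarrow> 'a::real_inner" and \<phi> :: "'a \<Rightarrow> real"
  assumes L: "L > 0" and c: "0 < c" "c < 1"
    and \<beta>: "\<And>k. 0 \<le> \<beta> k" "\<beta> 0 < 1" "decseq \<beta>"
    and \<gamma>: "\<And>k. \<gamma> k = 2 * (1 - \<beta> k) * c / L"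
    and D: "\<And>k. k \<ge> 2 \<Longrightarrow> x k \<in> D" "xs \<in> D"
    and min: "\<And>z. z \<in> D \<Longrightarrow> \<phi> xs \<le> \<phi> z"
    and bdd: "\<And>a. bounded {z \<in> D. \<phi> z \<le> a}"
    and step: "\<And>k z. k \<ge> 1 \<Longrightarrow> z \<in> D \<Longrightarrow> \<phi> (x (Suc k)) \<le> \<phi> z
      + 1 / \<gamma> k * ((\<beta> k *\<^sub>R (x k - x (k - 1)) - (x (Suc k) - x k)) \<bullet> (x (Suc k) - z))
      + L / 2 * (norm (x (Suc k) - x k))\<^sup>2"
  shows "\<exists>M. \<forall>k\<ge>3. \<phi> (x k) - \<phi> xs \<le> M / real k"
proof -
  define d where "d k = norm (x k - x (k - 1))" for k
  define \<eta> where "\<eta> = L * (1 - c) / (2 * c)"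
  define \<delta> where "\<delta> k = \<beta> k / (2 * \<gamma> k)" for k
  \<comment> \<open>The weight \<open>\<eta> / 2\<close> is half of the available decrease
    \<open>\<eta>\<close>, so that the drop of \<open>E\<close> controls both \<open>d k\<close> and
    \<open>d (Suc k)\<close>.\<close>
  define E where "E k = \<phi> (x k) - \<phi> xs + (\<delta> k + \<eta> / 2) * (d k)\<^sup>2" for k
  define G where "G = 1 / \<gamma> 0"
  have \<eta>: "\<eta> > 0"
    using L c by (simp add: \<eta>_def)
  have d0: "d k \<ge> 0" for k
    by (simp add: d_def)
  have dSuc: "d (Suc k) = norm (x (Suc k) - x k)" for k
    by (simp add: d_def)
  have \<beta>le: "\<beta> j \<le> \<beta> k" if "k \<le> j" for j k
    using \<beta>(3) that by (simp add: decseq_def)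
  have \<beta>1: "\<beta> k < 1" for k
    using \<beta>le[of 0 k] \<beta>(2) by simp
  have \<gamma>pos: "\<gamma> k > 0" for k
    using \<beta>1[of k] L c by (simp add: \<gamma>)
  have \<gamma>mono: "\<gamma> k \<le> \<gamma> j" if "k \<le> j" for j k
    using \<beta>le[OF that] L c by (simp add: \<gamma> divide_right_mono)
  have \<delta>0: "\<delta> k \<ge> 0" for k
    using \<beta>(1)[of k] \<gamma>pos[of k] by (simp add: \<delta>_def)
  have \<delta>le: "\<delta> j \<le> \<delta> k" if "k \<le> j" for j k
    unfolding \<delta>_def using \<beta>le[OF that] \<beta>(1)[of k] \<gamma>mono[OF that] \<gamma>pos[of k]
    by (intro frac_le) auto
  have invG: "1 / \<gamma> k \<le> G" for k
    unfolding G_def using \<gamma>mono[of 0 k] \<gamma>pos[of 0] by (intro divide_left_mono) auto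
  have \<delta>G: "\<delta> k \<le> G" for k
  proof -
    have "\<delta> k \<le> 1 / \<gamma> k"
      using \<beta>1[of k] \<gamma>pos[of k] by (simp add: \<delta>_def field_simps)
    then show ?thesis
      using invG[of k] by linarith
  qed
  have Gpos: "G > 0"
    using \<gamma>pos by (simp add: G_def)
  \<comment> \<open>The step size makes \<open>(1 - \<beta> k) / \<gamma> k\<close> the constant
    \<open>L / (2 * c)\<close>; \<open>\<eta>\<close> is its excess over \<open>L / 2\<close>,
    positive because \<open>c < 1\<close>.\<close>
  have coeff: "\<delta> k - 1 / \<gamma> k + L / 2 = - \<delta> k - \<eta>" for k
  proof -
    have "1 / \<gamma> k - \<beta> k / \<gamma> k = (1 - \<beta> k) / \<gamma> k"
      by (simp add: diff_divide_distrib)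
    also have "\<dots> = L / (2 * c)"
    proof -
      have "1 - \<beta> k \<noteq> 0"
        using \<beta>1[of k] by simp
      moreover have "\<gamma> k = (1 - \<beta> k) * (2 * c / L)"
        by (simp add: \<gamma>)
      ultimately show ?thesis
        by (simp del: right_diff_distrib left_diff_distrib left_diff_distrib' right_diff_distrib')
    qed
    finally have "1 / \<gamma> k - \<beta> k / \<gamma> k = L / (2 * c)" .
    moreover have "\<eta> = L / (2 * c) - L / 2"
      using c by (simp add: \<eta>_def field_simps)
    ultimately show ?thesis
      by (simp add: \<delta>_def)
  qed
  have Edec: "E (Suc k) \<le> E k - \<eta> / 2 * ((d k)\<^sup>2 + (d (Suc k))\<^sup>2)" if k: "k \<ge> 2" for k
  proof -
    \<comment> \<open>Young's inequality splits the inertial cross term into two squares: one is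
      absorbed by \<open>E k\<close>, the other enters \<open>coeff\<close>.\<close>
    have s: "(x k - x (k - 1)) \<bullet> (x (Suc k) - x k) \<le> ((d k)\<^sup>2 + (d (Suc k))\<^sup>2) / 2"
    proof -
      have "(x k - x (k - 1)) \<bullet> (x (Suc k) - x k) \<le> d k * d (Suc k)"
        unfolding d_def by (simp add: norm_cauchy_schwarz)
      also have "\<dots> \<le> ((d k)\<^sup>2 + (d (Suc k))\<^sup>2) / 2"
        using sum_squares_bound[of "d k" "d (Suc k)"] by simp
      finally show ?thesis .
    qed
    have "\<phi> (x (Suc k)) \<le> \<phi> (x k)
        + 1 / \<gamma> k * ((\<beta> k *\<^sub>R (x k - x (k - 1)) - (x (Suc k) - x k)) \<bullet> (x (Suc k) - x k))
        + L / 2 * (d (Suc k))\<^sup>2"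
      unfolding dSuc using step[of k "x k"] D(1)[of k] k by simp
    also have "(\<beta> k *\<^sub>R (x k - x (k - 1)) - (x (Suc k) - x k)) \<bullet> (x (Suc k) - x k)
        = \<beta> k * ((x k - x (k - 1)) \<bullet> (x (Suc k) - x k)) - (d (Suc k))\<^sup>2"
      by (simp only: inner_diff_left[of "\<beta> k *\<^sub>R (x k - x (k - 1))" "x (Suc k) - x k"]
          inner_scaleR_left dSuc power2_norm_eq_inner)
    also have "1 / \<gamma> k * \<dots>
        = 2 * \<delta> k * ((x k - x (k - 1)) \<bullet> (x (Suc k) - x k)) - 1 / \<gamma> k * (d (Suc k))\<^sup>2"
      by (simp add: \<delta>_def right_diff_distrib)
    also have "2 * \<delta> k * ((x k - x (k - 1)) \<bullet> (x (Suc k) - x k))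
        \<le> \<delta> k * ((d k)\<^sup>2 + (d (Suc k))\<^sup>2)"
      using mult_left_mono[OF s, of "2 * \<delta> k"] \<delta>0[of k] by simp
    finally have "\<phi> (x (Suc k)) \<le> \<phi> (x k) + \<delta> k * (d k)\<^sup>2
        + (\<delta> k - 1 / \<gamma> k + L / 2) * (d (Suc k))\<^sup>2"
      by (simp add: algebra_simps)
    then have "\<phi> (x (Suc k)) \<le> \<phi> (x k) + \<delta> k * (d k)\<^sup>2 + (- \<delta> k - \<eta>) * (d (Suc k))\<^sup>2"
      unfolding coeff .
    moreover have "\<delta> (Suc k) * (d (Suc k))\<^sup>2 \<le> \<delta> k * (d (Suc k))\<^sup>2"
      by (intro mult_right_mono \<delta>le) auto
    ultimately show ?thesis
      by (simp add: E_def algebra_simps)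
  qed
  have Emono: "E k \<le> E 2" if "k \<ge> 2" for k
    using that
  proof (induction k rule: dec_induct)
    case (step k)
    have "0 \<le> \<eta> / 2 * ((d k)\<^sup>2 + (d (Suc k))\<^sup>2)"
      using \<eta> by simp
    then show ?case
      using Edec[of k] step by linarith
  qed simp
  have gap: "\<phi> (x k) - \<phi> xs \<le> E k" for k
    using \<delta>0[of k] \<eta> by (simp add: E_def)
  \<comment> \<open>The maximum puts \<open>xs\<close> in the same level set as the iterates,
    whatever the sign of \<open>E 2\<close>.\<close>
  define a where "a = max (\<phi> xs) (\<phi> xs + E 2)"
  obtain B where B: "\<And>z. z \<in> D \<Longrightarrow> \<phi> z \<le> a \<Longrightarrow> norm z \<le> B"
    using bdd[of a] by (auto simp: bounded_iff)
  define R where "R = 2 * B"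
  have xB: "norm (x k) \<le> B" if "k \<ge> 2" for k
    using B[OF D(1)[OF that]] gap[of k] Emono[OF that] by (simp add: a_def)
  have xsB: "norm xs \<le> B"
    using B[OF D(2)] by (simp add: a_def)
  have xR: "norm (x k - xs) \<le> R" if "k \<ge> 2" for k
    using norm_triangle_ineq4[of "x k" xs] xB[OF that] xsB by (simp add: R_def)
  \<comment> \<open>\<open>d 2\<close> involves \<open>x 1\<close>, which may lie outside
    \<open>D\<close>; hence the start at 3.\<close>
  have dR: "d k \<le> R" if "k \<ge> 3" for k
  proof -
    have "2 \<le> k" "2 \<le> k - 1"
      using that by auto
    then show ?thesis
      using norm_triangle_ineq4[of "x k" "x (k - 1)"] xB[of k] xB[of "k - 1"]
      unfolding R_def d_def by linarith
  qed
  have R0: "R \<ge> 0"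
    using xR[of 2] norm_ge_zero[of "x 2 - xs"] by linarith
  \<comment> \<open>The summands bound, in order, the inner product, the term
    \<open>L / 2 * (d (Suc k))\<^sup>2\<close> and the \<open>d\<close>-part of
    \<open>E (Suc k)\<close>; squares become linear through
    \<open>d (Suc k) \<le> R\<close>.\<close>
  define C where "C = G * R + L / 2 * R + (G + \<eta> / 2) * R"
  have C0: "C \<ge> 0"
    using Gpos R0 L \<eta> by (simp add: C_def)
  have Elin: "E (Suc k) \<le> C * (d k + d (Suc k))" if k: "k \<ge> 3" for k
  proof -
    define v where "v = \<beta> k *\<^sub>R (x k - x (k - 1)) - (x (Suc k) - x k)"
    have "norm v \<le> \<beta> k * d k + d (Suc k)"
      using norm_triangle_ineq4[of "\<beta> k *\<^sub>R (x k - x (k - 1))" "x (Suc k) - x k"] \<beta>(1)[of k]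
      by (simp add: v_def d_def)
    moreover have "\<beta> k * d k \<le> d k"
      using \<beta>1[of k] d0[of k] mult_right_mono[of "\<beta> k" 1 "d k"] by simp
    ultimately have v: "norm v \<le> d k + d (Suc k)"
      by linarith
    have "v \<bullet> (x (Suc k) - xs) \<le> norm v * norm (x (Suc k) - xs)"
      by (rule norm_cauchy_schwarz)
    also have "\<dots> \<le> (d k + d (Suc k)) * R"
      using v xR[of "Suc k"] k d0[of k] d0[of "Suc k"] by (intro mult_mono) auto
    finally have "1 / \<gamma> k * (v \<bullet> (x (Suc k) - xs)) \<le> 1 / \<gamma> k * ((d k + d (Suc k)) * R)"
      using \<gamma>pos[of k] by (intro mult_left_mono) auto
    also have "\<dots> \<le> G * ((d k + d (Suc k)) * R)"
      using R0 d0 invG[of k] by (intro mult_right_mono) auto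
    finally have 1: "1 / \<gamma> k * (v \<bullet> (x (Suc k) - xs)) \<le> G * R * (d k + d (Suc k))"
      by (simp add: mult.commute mult.left_commute)
    have sq: "(d (Suc k))\<^sup>2 \<le> R * (d k + d (Suc k))"
      unfolding power2_eq_square using dR[of "Suc k"] k d0 R0 by (intro mult_mono) auto
    have "L / 2 * (d (Suc k))\<^sup>2 \<le> L / 2 * (R * (d k + d (Suc k)))"
      using sq L by (intro mult_left_mono) auto
    moreover have "(\<delta> (Suc k) + \<eta> / 2) * (d (Suc k))\<^sup>2 \<le> (G + \<eta> / 2) * (R * (d k + d (Suc k)))"
      using sq \<delta>G[of "Suc k"] Gpos \<eta> by (intro mult_mono) auto
    moreover have "\<phi> (x (Suc k)) - \<phi> xs
        \<le> 1 / \<gamma> k * (v \<bullet> (x (Suc k) - xs)) + L / 2 * (d (Suc k))\<^sup>2"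
      unfolding dSuc using step[of k xs] D(2) k by (simp add: v_def)
    ultimately have "E (Suc k) \<le> G * R * (d k + d (Suc k)) + L / 2 * (R * (d k + d (Suc k)))
        + (G + \<eta> / 2) * (R * (d k + d (Suc k)))"
      using 1 unfolding E_def by linarith
    then show ?thesis
      by (simp only: C_def distrib_right mult.assoc)
  qed
  have rec: "(E (Suc k))\<^sup>2 \<le> (4 * C\<^sup>2 / \<eta>) * (E k - E (Suc k))" if k: "k \<ge> 3" for k
  proof -
    \<comment> \<open>Nonnegativity allows squaring \<open>Elin\<close>;
      \<open>(s + t)\<^sup>2 \<le> 2 * (s\<^sup>2 + t\<^sup>2)\<close> then brings in the drop from
      \<open>Edec\<close>.\<close>
    have "E (Suc k) \<ge> 0"
      using gap[of "Suc k"] min[OF D(1)[of "Suc k"]] k by simp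
    then have "(E (Suc k))\<^sup>2 \<le> (C * (d k + d (Suc k)))\<^sup>2"
      using Elin[OF k] by (intro power_mono)
    also have "\<dots> = C\<^sup>2 * (d k + d (Suc k))\<^sup>2"
      by (simp add: power_mult_distrib)
    also have "\<dots> \<le> C\<^sup>2 * (2 * ((d k)\<^sup>2 + (d (Suc k))\<^sup>2))"
      using sum_squares_bound[of "d k" "d (Suc k)"]
      by (intro mult_left_mono) (auto simp: power2_sum)
    also have "\<dots> = (4 * C\<^sup>2 / \<eta>) * (\<eta> / 2 * ((d k)\<^sup>2 + (d (Suc k))\<^sup>2))"
      using \<eta> by (simp add: field_simps)
    also have "\<dots> \<le> (4 * C\<^sup>2 / \<eta>) * (E k - E (Suc k))"
      using Edec[of k] k \<eta> by (intro mult_left_mono) auto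
    finally show ?thesis .
  qed
  have "\<exists>M. \<forall>k\<ge>3. E k \<le> M / real k"
    by (rule quadratic_recurrence_rate[where K = "4 * C\<^sup>2 / \<eta>"]) (use \<eta> rec in auto)
  then show ?thesis
    using gap order_trans by blast
qed

section \<open>Passage from extended-valued \<open>F\<close> to the energy argument\<close>

theorem theorem1:
  fixes f :: "real ^ 'n \<Rightarrow> real"
    and gradf :: "real ^ 'n \<Rightarrow> real ^ 'n"
    and g F :: "real ^ 'n \<Rightarrow> ereal"
    and L c :: real
    and \<beta> \<gamma> :: "nat \<Rightarrow> real"
    and x :: "nat \<Rightarrow> real ^ 'n"
  assumes f_convex: "convex_on UNIV f"
    and f_grad: "\<And>z. GDERIV f z :> gradf z"
    and L_pos: "L > 0"
    and grad_lipschitz: "L-lipschitz_on UNIV gradf"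
    and g_proper: "proper_fun g"
    and g_lsc: "lsc_fun g"
    and g_convex: "convex_fun g"
    and F_eq: "\<And>z. F z = ereal (f z) + g z"
    and F_bounded_below: "(INF z. F z) > - \<infinity>"
    and F_coercive: "coercive_fun F"
    and beta_range: "\<And>k. 0 \<le> \<beta> k \<and> \<beta> k < 1"
    and beta_decseq: "decseq \<beta>"
    and beta_inf: "0 < (INF k. \<beta> k)"
    and beta_bounds: "\<And>k. (INF j. \<beta> j) \<le> \<beta> k \<and> \<beta> k \<le> \<beta> 0"
    and beta_0: "\<beta> 0 < 1"
    and c_range: "0 < c" "c < 1"
    and gamma_eq: "\<And>k. \<gamma> k = 2 * (1 - \<beta> k) * c / L"
    and iteration: "\<And>k. k \<ge> 1 \<Longrightarrow>
      x (k + 1) = prox (\<gamma> k) g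
        (x k - \<gamma> k *\<^sub>R gradf (x k) + \<beta> k *\<^sub>R (x k - x (k - 1)))"
  shows "(\<forall>\<^sub>F k in sequentially. \<bar>F (x k) - min_value F\<bar> \<noteq> \<infinity>) \<and>
    (\<lambda>k. real_of_ereal (F (x k) - min_value F)) \<in> O(\<lambda>k. 1 / real k)"
proof -
  \<comment> \<open>On \<open>D\<close>, \<open>\<phi>\<close> is the finite value of
    \<open>F\<close>. Off \<open>D\<close> it degenerates to \<open>f z\<close>, as
    \<open>real_of_ereal\<close> sends infinity to 0, so \<open>\<phi>\<close> is compared only on
    \<open>D\<close>.\<close>
  define \<phi> where "\<phi> z = f z + real_of_ereal (g z)" for z
  define D where "D = {z. \<bar>g z\<bar> \<noteq> \<infinity>}"
  note g = g_proper g_lsc g_convex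
  have F_D: "F z = ereal (\<phi> z)" if "z \<in> D" for z
    using that by (cases "g z") (auto simp: F_eq \<phi>_def D_def)
  have F_notD: "F z = \<infinity>" if "z \<notin> D" for z
    using that g_proper by (cases "g z") (auto simp: F_eq D_def proper_fun_def)
  have \<gamma>pos: "\<gamma> k > 0" for k
    using beta_range[of k] c_range L_pos by (simp add: gamma_eq)
  have x_step: "x (Suc k) = prox (\<gamma> k) g
      (x k - \<gamma> k *\<^sub>R gradf (x k) + \<beta> k *\<^sub>R (x k - x (k - 1)))" if "k \<ge> 1" for k
    using iteration[OF that] by simp
  \<comment> \<open>The first point produced by \<open>prox\<close> is \<open>x 2\<close>.\<close>
  have x_D: "x k \<in> D" if "k \<ge> 2" for k
    using that prox_finite[OF g \<gamma>pos] x_step[of "k - 1"] by (simp add: D_def)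
  have levels: "bounded {z. F z \<le> ereal a}" for a
  proof -
    have "\<forall>\<^sub>F z in at_infinity. ereal a < F z"
      using F_coercive by (simp add: coercive_fun_def tendsto_PInfty)
    then obtain b where b: "\<forall>z. b \<le> norm z \<longrightarrow> ereal a < F z"
      unfolding eventually_at_infinity by blast
    have "norm z \<le> b" if "F z \<le> ereal a" for z
      using b that by (meson linear not_le)
    then show ?thesis
      unfolding bounded_iff by blast
  qed
  have "continuous_on UNIV f"
    using f_grad unfolding gderiv_def
    by (intro has_derivative_continuous_on) (rule has_derivative_at_withinI)
  then have "lsc_fun F"
    unfolding F_eq[abs_def] by (intro lsc_fun_add_continuous g_lsc)
  \<comment> \<open>\<open>F (x 2)\<close> is finite, so coercivity bounds this level set and a
    minimiser exists.\<close>
  moreover have "bounded {z. F z \<le> F (x 2)}"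
    unfolding F_D[OF x_D[OF order_refl]] by (rule levels)
  ultimately obtain xs where xs: "\<And>z. F xs \<le> F z"
    using lsc_fun_attains_global_min[of F "x 2"] by auto
  have xs_D: "xs \<in> D"
    using xs[of "x 2"] F_D[OF x_D[of 2]] F_notD[of xs] by (cases "xs \<in> D") auto
  \<comment> \<open>The point chosen inside \<open>min_value\<close> may differ from
    \<open>xs\<close>, but the values agree.\<close>
  have min_F: "min_value F = ereal (\<phi> xs)"
    unfolding min_value_def F_D[OF xs_D, symmetric]
    by (intro antisym xs ARG_MIN_le[of F, OF xs])
  have min_\<phi>: "\<phi> xs \<le> \<phi> z" if "z \<in> D" for z
    using xs[of z] by (simp add: F_D that xs_D)
  have "\<exists>M. \<forall>k\<ge>3. \<phi> (x k) - \<phi> xs \<le> M / real k"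
  proof (rule inertial_descent_rate[where D = D])
    show "bounded {z \<in> D. \<phi> z \<le> a}" for a
      by (rule bounded_subset[OF levels[of a]]) (auto simp: F_D)
    show "\<phi> (x (Suc k)) \<le> \<phi> z
        + 1 / \<gamma> k * ((\<beta> k *\<^sub>R (x k - x (k - 1)) - (x (Suc k) - x k)) \<bullet> (x (Suc k) - z))
        + L / 2 * (norm (x (Suc k) - x k))\<^sup>2" if "k \<ge> 1" "z \<in> D" for k z
      unfolding \<phi>_def
      by (rule prox_gradient_step[OF f_convex f_grad grad_lipschitz g \<gamma>pos _ x_step[OF that(1)]])
        (use that(2) in \<open>simp add: D_def\<close>)
  qed (use L_pos c_range beta_range beta_0 beta_decseq gamma_eq x_D xs_D min_\<phi> in auto)
  then obtain M where M: "\<And>k. k \<ge> 3 \<Longrightarrow> \<phi> (x k) - \<phi> xs \<le> M / real k"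
    by blast
  have diff: "F (x k) - min_value F = ereal (\<phi> (x k) - \<phi> xs)" if "k \<ge> 3" for k
    using that by (simp add: F_D x_D min_F)
  have "\<forall>\<^sub>F k in sequentially. \<bar>F (x k) - min_value F\<bar> \<noteq> \<infinity>"
    using eventually_ge_at_top[of 3] by eventually_elim (simp add: diff)
  moreover have "(\<lambda>k. real_of_ereal (F (x k) - min_value F)) \<in> O(\<lambda>k. 1 / real k)"
  \<comment> \<open>\<open>M\<close> bounds the gap from above only; the norm is resolved by
    \<open>min_\<phi>\<close>, which makes the gap nonnegative.\<close>
  proof (rule bigoI)
    show "\<forall>\<^sub>F k in sequentially.
        norm (real_of_ereal (F (x k) - min_value F)) \<le> M * norm (1 / real k)"
      using eventually_ge_at_top[of 3]
    proof eventually_elim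
      case (elim k)
      then show ?case
        using M[of k] min_\<phi>[OF x_D[of k]] by (simp add: diff)
    qed
  qed
  ultimately show ?thesis
    by blast
qed

end
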